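(* Let $p<q<r$ be odd primes. Suppose that $\min\{\overline{q_{p}},\, p-\overline{q_{p}},\, \overline{r_{p}},\, p-\overline{r_{p}}\}>\frac{p-1}{3}$. Then $A(pqr)\leqslant \frac{2}{3}p$.
   Context: For a positive integer $n$, $\Phi_n(x)=\sum_{i=0}^{\phi(n)}c_i x^i$ denotes the $n$th cyclotomic polynomial ($\phi$ is Euler's totient function), and $A(n)=\max\{|c_i| : 0\leqslant i\leqslant \phi(n)\}$ is the largest absolute value of its coefficients. For odd primes $p<q<r$: $\overline{q_{p}}$ is the unique integer with $0<\overline{q_{p}}<p$ and $q\equiv\overline{q_{p}}\pmod p$, and $\overline{r_{p}}$ is the unique integer with $0<\overline{r_{p}}<p$ and $r\equiv\overline{r_{p}}\pmod p$. *)

theory Defs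
  imports
    Complex_Main
    "HOL-Computational_Algebra.Polynomial"
    "HOL-Number_Theory.Totient"
begin

text \<open>
  The \<open>n\<close>th cyclotomic polynomial for positive \<open>n\<close>: the monic polynomial whose roots are the
  primitive \<open>n\<close>th roots of unity \<open>exp (2 \<pi> i k / n)\<close>, \<open>0 < k \<le> n\<close>, \<open>gcd k n = 1\<close>.  Its
  coefficients are integers; here they are regarded as complex numbers.
\<close>

definition cyclotomic_poly :: "nat \<Rightarrow> complex poly" where
  "cyclotomic_poly n = (\<Prod>k\<in>totatives n. [:- cis (2 * pi * real k / real n), 1:])"

definition cyclotomic_height :: "nat \<Rightarrow> real" where
  "cyclotomic_height n = Max ((\<lambda>i. cmod (poly.coeff (cyclotomic_poly n) i)) ` {0..totient n})"

end

theory Submission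
  imports Defs "HOL-Number_Theory.Cong" "HOL-Computational_Algebra.Fundamental_Theorem_Algebra"
begin

text \<open>
  Put \<open>d = q mod p\<close> and let \<open>u\<close>, \<open>v\<close> be the inverses of \<open>q\<close>, \<open>r\<close> modulo \<open>p\<close>.  Expanding the quotient
  formula for the cyclotomic polynomial writes its coefficient at \<open>n\<close> as a sum over \<open>j < p\<close> of
  differences \<open>G(a, b) - G(a - v, b)\<close>.  Here \<open>(a, b)\<close> are the coordinates of \<open>n - j\<close> on the torus of
  residues modulo \<open>p\<close> and \<open>q\<close>, so that \<open>a\<close> takes every value once, and \<open>G\<close> is a coefficient of the
  cyclotomic polynomial of index \<open>p q\<close>, cut off at an exponent depending on \<open>n\<close>
  (\<open>coeff_cyclotomic_poly_pqr\<close>, \<open>box_count_diff\<close>).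

  The residue \<open>d\<close> matters for the following reason.  Replacing \<open>j\<close> by \<open>(j + d) mod p\<close> changes \<open>a\<close> by
  \<open>-v\<close>, and it changes \<open>b\<close> by one of only two amounts: by \<open>x\<close> if \<open>j + d < p\<close>, which happens
  \<open>p - d\<close> times, and by \<open>y\<close> otherwise, which happens \<open>d\<close> times.  The coefficient is thus the sum of
  the changes of \<open>-G\<close> over the horizontal steps of a closed staircase, and equally the sum of
  the changes of \<open>G\<close> over its vertical steps.  Every single change is at most 1, so the sum is at most
  \<open>p\<close>, and one has to save \<open>p / 3\<close>.  Reflections of
  the torus and, if necessary, the exchange of \<open>q\<close> and \<open>r\<close> allow the assumption \<open>u \<le> v\<close>,
  \<open>u + v \<le> p\<close>; because of the exchange both residues have to be controlled.

  For a fixed column \<open>a\<close> the function \<open>G\<close> is, up to sign, the indicator of an interval of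
  heights, and on either side of \<open>a = u\<close> this interval shrinks as \<open>a\<close> grows.  Therefore two successive vertical
  steps can both be gains only under severe restrictions.  Call a vertical step short if it is
  positive and less than the length \<open>q - t\<close> of the strip that contains the negative values of \<open>G\<close>.
  If no step is short, at most two out of any three successive steps are gains
  (\<open>bound_no_short\<close>).  If exactly one of \<open>x\<close>, \<open>y\<close> is short, a step that is not short and a short
  one after it are never both gains; this pattern occurs \<open>min(d, p - d)\<close> times, which is at least
  \<open>p / 3\<close> by hypothesis (\<open>bound_one_short\<close>).  If both are short, the heights move so slowly
  that a horizontal gain with \<open>a < u\<close> and \<open>b < t\<close> is never followed by a gain in a high column, and
  counting columns saves \<open>p / 3\<close> (\<open>bound_both_short\<close>).
\<close>

section \<open>Auxiliary facts\<close>

text \<open>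
  Disjoint pairs whose two values together contribute at most 1 each cost one unit against the
  trivial bound \<^term>\<open>card S\<close>.  Conflicts between neighbours on the staircase are used this way.
\<close>

lemma sum_le_card_minus_pairs:
  fixes f :: "'a \<Rightarrow> int"
  assumes fin: "finite S" and le1: "\<And>x. x \<in> S \<Longrightarrow> f x \<le> 1"
    and Z: "Z \<subseteq> S" "inj_on \<sigma> Z" "\<sigma> ` Z \<subseteq> S" "Z \<inter> \<sigma> ` Z = {}"
    and pair: "\<And>x. x \<in> Z \<Longrightarrow> f x + f (\<sigma> x) \<le> 1"
  shows "sum f S \<le> int (card S) - int (card Z)"
proof -
  have finZ: "finite Z" "finite (\<sigma> ` Z)" using fin Z finite_subset by blast+
  define R where "R = S - (Z \<union> \<sigma> ` Z)"
  have S: "S = R \<union> (Z \<union> \<sigma> ` Z)" and disj: "R \<inter> (Z \<union> \<sigma> ` Z) = {}"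
    using Z by (auto simp: R_def)
  have finR: "finite R" using fin by (simp add: R_def)
  have "sum f S = sum f R + (sum f Z + sum f (\<sigma> ` Z))"
    using S disj finR finZ Z(4) by (simp add: sum.union_disjoint)
  also have "sum f (\<sigma> ` Z) = (\<Sum>x\<in>Z. f (\<sigma> x))"
    using Z(2) by (simp add: sum.reindex o_def)
  also have "sum f Z + (\<Sum>x\<in>Z. f (\<sigma> x)) = (\<Sum>x\<in>Z. f x + f (\<sigma> x))"
    by (simp add: sum.distrib)
  also have "\<dots> \<le> (\<Sum>x\<in>Z. 1)" by (intro sum_mono pair)
  also have "sum f R \<le> (\<Sum>x\<in>R. 1)" by (intro sum_mono le1) (auto simp: R_def)
  finally have "sum f S \<le> int (card R) + int (card Z)" by simp
  moreover have "card S = card R + (card Z + card Z)"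
    using S disj finR finZ Z(2,4) by (simp add: card_Un_disjoint card_image)
  ultimately show ?thesis by simp
qed

lemma int_div_less_iff:
  fixes q :: int
  assumes "0 < q"
  shows "x div q < a \<longleftrightarrow> x < a * q"
proof
  assume "x div q < a"
  then have "q * (x div q + 1) \<le> q * a" using assms by (intro mult_left_mono) auto
  moreover have "x = q * (x div q) + x mod q" "x mod q < q" using assms by simp_all
  moreover have "q * (x div q + 1) = q * (x div q) + q" by (simp add: algebra_simps)
  ultimately have "x < q * a" by linarith
  then show "x < a * q" by (simp add: mult.commute)
next
  assume "x < a * q"
  show "x div q < a"
  proof (rule ccontr)
    assume "\<not> x div q < a"
    then have "q * a \<le> q * (x div q)" using assms by (intro mult_left_mono) auto
    moreover have "q * (x div q) + x mod q = x" "0 \<le> x mod q" using assms by simp_all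
    ultimately show False using \<open>x < a * q\<close> by (simp add: algebra_simps)
  qed
qed

lemma diff_mod_eq:
  fixes x k l :: int
  assumes "0 \<le> x" "x < l" "0 < k" "k < l"
  shows "(x - k) mod l = (if x < k then x - k + l else x - k)"
proof (cases "x < k")
  case True
  have "(x - k) mod l = (x - k + l) mod l" by simp
  also have "\<dots> = x - k + l" using True assms by (intro mod_pos_pos_trivial) auto
  finally show ?thesis using True by simp
qed (use assms in simp)

section \<open>Local conflicts between neighbouring contributions\<close>

text \<open>
  Let \<open>u q + t p = p q + 1\<close>.  Every residue modulo \<open>p q\<close> is \<open>a q + b p\<close> with \<open>0 \<le> a < p\<close> and
  \<open>0 \<le> b < q\<close>, and the coefficient of the cyclotomic polynomial of index \<open>p q\<close> there is \<open>1\<close> if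
  \<open>a < u\<close> and \<open>b < t\<close>, it is \<open>-1\<close> if \<open>a \<ge> u\<close> and \<open>b \<ge> t\<close>, and \<open>0\<close> otherwise.  The exponent itself
  is \<open>a q + b p\<close> in the first case and \<open>a q + b p - p q\<close> in the second.  The function below is
  this coefficient, cut off at exponents above \<open>N\<close>.
\<close>

definition cut_coeff :: "int \<Rightarrow> int \<Rightarrow> int \<Rightarrow> int \<Rightarrow> int \<Rightarrow> int \<Rightarrow> int \<Rightarrow> int" where
  "cut_coeff p q u t N a b =
    (if a < u then (if b < t \<and> a * q + b * p \<le> N then 1 else 0)
     else (if t \<le> b \<and> a * q + b * p \<le> N + p * q then -1 else 0))"

text \<open>
  The parameter \<open>v\<close> is the size of a horizontal step.  The weakened Bezout relation admits
  \<open>u q + t p = p q - 1\<close> as well, because the reflection \<open>u \<mapsto> p - u\<close>, \<open>t \<mapsto> q - t\<close> produces this sign.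
\<close>

locale descent =
  fixes p q u v t N :: int
  assumes u_pos: "0 < u" and u_le_v: "u \<le> v" and uv_le: "u + v \<le> p" and q_pos: "0 < q"
    and bezout: "\<bar>u * q + t * p - p * q\<bar> \<le> 1"
begin

abbreviation G :: "int \<Rightarrow> int \<Rightarrow> int" where "G \<equiv> cut_coeff p q u t N"
abbreviation down :: "int \<Rightarrow> int" where "down a \<equiv> (a - v) mod p"

lemma p_pos: "0 < p" and v_pos: "0 < v" and v_less: "v < p"
  using u_pos u_le_v uv_le by linarith+

lemma down_eq:
  assumes "0 \<le> a" "a < p"
  shows "down a = (if a < v then a - v + p else a - v)"
  using diff_mod_eq[OF assms v_pos v_less] .

lemma vq_le: "v * q \<le> p * q" and uq_le: "u * q \<le> v * q"
  using v_less q_pos u_le_v by (auto intro: mult_right_mono)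

text \<open>
  Here \<open>b0\<close>, \<open>b\<close>, \<open>b1\<close> are three consecutive heights of the staircase, and \<open>a\<close>, \<^term>\<open>down a\<close> are the
  columns in which it passes from \<open>b0\<close> to \<open>b\<close> and from \<open>b\<close> to \<open>b1\<close>.  After the wrap-around the column
  \<^term>\<open>down a\<close> is the larger one and at least \<open>u\<close>, so a gain there starts from a height \<open>b \<ge> t\<close> with
  coefficient \<open>-1\<close>.  If \<open>a < u\<close>, a gain in \<open>a\<close> ends at a height below \<open>t\<close>.  If \<open>a \<ge> u\<close>, it ends outside the
  heights with coefficient \<open>-1\<close> for \<open>a\<close>, but those include the ones for the larger column.
\<close>

lemma wrap_conflict:
  assumes "0 \<le> a" "a < v"
  shows "(G a b - G a b0) + (G (down a) b1 - G (down a) b) \<le> 1"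
proof -
  have d: "down a = a - v + p" using down_eq assms v_less by simp
  have "\<not> a - v + p < u" using assms uv_le by linarith
  then show ?thesis unfolding d cut_coeff_def using assms vq_le
    by (auto simp: algebra_simps)
qed

text \<open>
  If both columns are at least \<open>u\<close>, two successive gains are possible, but then \<open>b0 < b\<close> both lie in
  the interval from \<open>t\<close> to \<open>q\<close>, so the vertical step between them is shorter than \<open>q - t\<close>.
\<close>

lemma free_short:
  assumes "u + v \<le> a" "a < p" "b0 < q" "b < q"
    and 1: "G a b - G a b0 = 1" "G (down a) b1 - G (down a) b = 1"
  shows "0 < b - b0" "b - b0 < q - t"
proof -
  have d: "down a = a - v" using down_eq assms u_pos v_pos by simp
  have ge: "\<not> a < u" "\<not> a - v < u" using assms v_pos by linarith+
  have *: "t \<le> b0" "a * q + b0 * p \<le> N + p * q" "\<not> (t \<le> b \<and> a * q + b * p \<le> N + p * q)" "t \<le> b"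
    using 1 ge unfolding d cut_coeff_def by (auto split: if_splits)
  then have "b0 * p < b * p" by linarith
  then have "b0 < b" using p_pos by (simp add: mult_less_cancel_right)
  with * assms show "0 < b - b0" "b - b0 < q - t" by linarith+
qed

text \<open>
  A step that is not short followed by a short one never yields two gains.  The new case is
  that stepping down enters the columns below \<open>u\<close>.  A short second step has to cross the height \<open>0\<close>
  upwards there, which places \<open>b\<close> in the interval from \<open>t\<close> to \<open>q\<close> again and makes the first step short.
\<close>

lemma long_short_conflict:
  assumes "0 \<le> a" "a < p" "0 \<le> b0" "b0 < q" "0 \<le> b" "b < q"
    and z: "b = (b0 + z) mod q" "0 \<le> z" "z < q" "\<not> (0 < z \<and> z < q - t)"
    and z': "b1 = (b + z') mod q" "0 < z'" "z' < q - t"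
  shows "(G a b - G a b0) + (G (down a) b1 - G (down a) b) \<le> 1"
proof (cases "a < v")
  case True
  then show ?thesis using wrap_conflict assms by blast
next
  case nw: False
  have le1: "G a b - G a b0 \<le> 1" "G (down a) b1 - G (down a) b \<le> 1"
    by (auto simp: cut_coeff_def)
  show ?thesis
  proof (rule ccontr)
    assume "\<not> ?thesis"
    then have 1: "G a b - G a b0 = 1" "G (down a) b1 - G (down a) b = 1" using le1 by linarith+
    have d: "down a = a - v" using down_eq assms nw by simp
    have no: False if "b0 < b" "t \<le> b0"
    proof -
      have "(b - b0) mod q = z mod q" unfolding z(1) by (simp add: mod_diff_left_eq)
      then have "z = b - b0" using that assms by simp
      with that assms z show False by linarith
    qed
    show False
    proof (cases "a < u + v")
      case False
      then have "u + v \<le> a" by simp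
      note fs = free_short[OF this \<open>a < p\<close> \<open>b0 < q\<close> \<open>b < q\<close> 1]
      from fs have "t \<le> b0" using 1 False v_pos unfolding cut_coeff_def by (auto split: if_splits)
      with fs no show False by auto
    next
      case True
      then have lt: "a - v < u" "\<not> a < u" using nw u_le_v by linarith+
      have A: "t \<le> b0" "a * q + b0 * p \<le> N + p * q" "\<not> (t \<le> b \<and> a * q + b * p \<le> N + p * q)"
        using 1(1) lt unfolding cut_coeff_def by (auto split: if_splits)
      have B: "b1 < t" "(a - v) * q + b1 * p \<le> N" "\<not> (b < t \<and> (a - v) * q + b * p \<le> N)"
        using 1(2) lt unfolding d cut_coeff_def by (auto split: if_splits)
      have "t \<le> b"
      proof (rule ccontr)
        assume "\<not> t \<le> b"
        then have b1: "b1 = b + z'" using z' assms by (simp add: mod_pos_pos_trivial)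
        then have "b * p \<le> b1 * p" using z' p_pos by (intro mult_right_mono) auto
        with B \<open>\<not> t \<le> b\<close> show False by linarith
      qed
      with A have "b0 * p < b * p" by linarith
      then have "b0 < b" using p_pos by (simp add: mult_less_cancel_right)
      then show False using no A by simp
    qed
  qed
qed

text \<open>
  The remaining lemmas of this context look at the horizontal steps.  No gain is possible in
  the columns from \<open>u\<close> to \<open>u + v\<close>, and above them a gain confines the column to a window of
  length \<open>u + v\<close> whose position is fixed by \<open>N\<close>.
\<close>

lemma fall_le_1: "0 \<le> a \<Longrightarrow> a < p \<Longrightarrow> G a b - G (down a) b \<le> 1"
  unfolding cut_coeff_def using u_le_v uv_le by (auto simp: down_eq)

lemma fall_nonpos:
  assumes "u \<le> a" "a < u + v"
  shows "G a b - G (down a) b \<le> 0"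
proof -
  have d: "down a = (if a < v then a - v + p else a - v)" using down_eq assms uv_le u_pos by simp
  show ?thesis
    unfolding d cut_coeff_def using assms vq_le uv_le by (auto simp: algebra_simps)
qed

lemma fall_high:
  assumes "u + v \<le> a" "a < p" "b < q" "G a b - G (down a) b = 1"
  shows "(N + p) div q < a" "a \<le> (N + p) div q + u + v"
proof -
  have d: "down a = a - v" using down_eq assms u_pos v_pos by simp
  have *: "t \<le> b" "N + p * q < a * q + b * p" "(a - v) * q + b * p \<le> N + p * q"
    using assms v_pos unfolding d cut_coeff_def by (auto split: if_splits)
  have bp: "b * p \<le> (q - 1) * p" "t * p \<le> b * p" using p_pos assms * by (auto intro: mult_right_mono)
  have "N + p < a * q" using bp * by (simp add: algebra_simps)
  then show "(N + p) div q < a" using q_pos by (simp add: int_div_less_iff)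
  have "(a - v) * q \<le> N + p * q - t * p" using bp * by linarith
  also have "\<dots> \<le> N + u * q + 1" using bezout by linarith
  finally have "(a - (u + v)) * q \<le> N + p" using p_pos by (simp add: algebra_simps)
  then have "a - (u + v) \<le> (N + p) div q"
    using int_div_less_iff[OF q_pos, of "N + p" "a - (u + v)"] by linarith
  then show "a \<le> (N + p) div q + u + v" by simp
qed

text \<open>
  A gain in a low column \<open>a < u\<close> is of one of two kinds.  Either \<open>b < t\<close>, and then a gain in the next
  column would force the height to grow by more than \<open>v q / p\<close>, which is more than a short step
  provides; or \<open>b \<ge> t\<close>, which the lower bound on \<open>a\<close> rules out.
\<close>

lemma fall_low_conflict:
  assumes a: "0 \<le> a" "a < u" "(N + p) div q + u + v - p < a" and v: "u + 2 * v \<le> p"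
    and b: "0 \<le> b" "b < q" "b1 = (b + z) mod q" "0 < z" "z < q - t"
  shows "(G a b - G (down a) b) + (G (down a) b1 - G (down (down a)) b1) \<le> 1"
proof (rule ccontr)
  have d: "down a = a - v + p" using down_eq a u_le_v v_less by simp
  have d2: "down (down a) = a - 2 * v + p" using down_eq[of "a - v + p"] a v u_le_v d u_pos by simp
  assume "\<not> ?thesis"
  moreover have "G a b - G (down a) b \<le> 1" using a u_le_v v_less by (intro fall_le_1) auto
  moreover have "G (down a) b1 - G (down (down a)) b1 \<le> 1" using p_pos by (intro fall_le_1) auto
  ultimately have 1: "G a b - G (down a) b = 1" "G (down a) b1 - G (down (down a)) b1 = 1" by linarith+
  have "(N + p) div q < a + p - u - v" using a by linarith
  then have "N + p < (a + p - u - v) * q" using q_pos by (simp add: int_div_less_iff)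
  then have nD2: "\<not> (t \<le> b \<and> (a - v + p) * q + b * p \<le> N + p * q)"
  proof (intro notI, elim conjE)
    assume "t \<le> b" "(a - v + p) * q + b * p \<le> N + p * q"
    note below = this
    have "t * p \<le> b * p" using below(1) p_pos by (intro mult_right_mono) auto
    moreover have "a * q - v * q + b * p \<le> N" using below(2) by (simp add: algebra_simps)
    moreover have "N + p < a * q + p * q - u * q - v * q"
      using \<open>N + p < (a + p - u - v) * q\<close> by (simp add: algebra_simps)
    ultimately show False using bezout p_pos by linarith
  qed
  have "b < t" "a * q + b * p \<le> N" using 1(1) a uv_le nD2 unfolding d cut_coeff_def
    by (auto split: if_splits)
  moreover have "\<not> a - v + p < u" "\<not> a - 2 * v + p < u" using a v u_pos v_pos by linarith+
  then have "t \<le> b1" "N + p * q < (a - v + p) * q + b1 * p"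
    using 1(2) unfolding d2 unfolding d cut_coeff_def by (auto split: if_splits)
  ultimately have lt: "b < b1" "v * q < (b1 - b) * p" by (auto simp: algebra_simps)
  have "b1 < q" using q_pos unfolding b(3) by simp
  moreover have "z < q" using b \<open>b < t\<close> by linarith
  ultimately have "(b1 - b) mod q = b1 - b" "z mod q = z"
    using lt(1) b(1) b(4) by simp_all
  moreover have "(b1 - b) mod q = z mod q" unfolding b(3) by (simp add: mod_diff_left_eq)
  ultimately have "z = b1 - b" by metis
  then have "z * p \<le> (q - t - 1) * p" using b(5) p_pos by (intro mult_right_mono) auto
  then have "z * p \<le> u * q" using bezout p_pos by (simp add: algebra_simps)
  then show False using lt \<open>z = b1 - b\<close> uq_le by simp
qed

end

section \<open>A closed staircase on the torus\<close>

text \<open>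
  The points with coordinates \<^term>\<open>al j\<close> and \<^term>\<open>be j\<close> are visited in the order \<open>j \<mapsto> (j + d) mod p\<close>.
  The staircase goes horizontally by \<open>-v\<close> and then vertically by \<open>x\<close>, or by \<open>y\<close> when \<open>j + d\<close>
  wraps around, and it closes up after passing through every column once.
\<close>

locale flow = descent +
  fixes d x y :: int and al be :: "int \<Rightarrow> int"
  assumes d: "0 < d" "d < p"
    and x: "0 \<le> x" "x < q" and y: "0 \<le> y" "y < q"
    and al_bij: "bij_betw al {0..<p} {0..<p}"
    and al_step: "\<And>j. 0 \<le> j \<Longrightarrow> j < p \<Longrightarrow> al ((j + d) mod p) = (al j - v) mod p"
    and be_range: "\<And>j. 0 \<le> be j \<and> be j < q"
    and be_step: "\<And>j. 0 \<le> j \<Longrightarrow> j < p \<Longrightarrow>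
       be ((j + d) mod p) = (be j + (if j + d < p then x else y)) mod q"
begin

definition succ :: "int \<Rightarrow> int" where "succ j = (j + d) mod p"
definition step :: "int \<Rightarrow> int" where "step j = (if j + d < p then x else y)"
definition rise :: "int \<Rightarrow> int" where "rise j = G (al (succ j)) (be (succ j)) - G (al (succ j)) (be j)"
definition fall :: "int \<Rightarrow> int" where "fall j = G (al j) (be j) - G (al (succ j)) (be j)"
definition short :: "int \<Rightarrow> bool" where "short z \<longleftrightarrow> 0 < z \<and> z < q - t"

lemma succ_eq: "0 \<le> j \<Longrightarrow> j < p \<Longrightarrow> succ j = (if j + d < p then j + d else j + d - p)"
proof (cases "j + d < p")
  case False
  assume "0 \<le> j" "j < p"
  have "(j + d) mod p = (j + d - p) mod p" by simp
  also have "\<dots> = j + d - p" using False \<open>j < p\<close> d by (intro mod_pos_pos_trivial) auto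
  finally show ?thesis using False by (simp add: succ_def)
qed (use d in \<open>simp add: succ_def\<close>)

lemma succ_range: "0 \<le> succ j" "succ j < p"
  using p_pos by (simp_all add: succ_def)

lemma succ_inj: "inj_on succ {0..<p}"
  by (rule inj_onI) (auto simp: succ_eq split: if_splits)

lemma succ_bij: "bij_betw succ {0..<p} {0..<p}"
proof -
  have "succ ` {0..<p} \<subseteq> {0..<p}" using succ_range by auto
  then show ?thesis using succ_inj by (simp add: bij_betw_def endo_inj_surj)
qed

lemma sum_succ: "(\<Sum>j\<in>{0..<p}. f (succ j)) = sum f {0..<p}"
  by (rule sum.reindex_bij_betw[OF succ_bij])

lemma al_range: "0 \<le> j \<Longrightarrow> j < p \<Longrightarrow> 0 \<le> al j \<and> al j < p"
  using al_bij by (auto simp: bij_betw_def)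

lemma al_succ: "0 \<le> j \<Longrightarrow> j < p \<Longrightarrow> al (succ j) = down (al j)"
  unfolding succ_def by (rule al_step)

lemma be_succ: "0 \<le> j \<Longrightarrow> j < p \<Longrightarrow> be (succ j) = (be j + step j) mod q"
  unfolding succ_def step_def by (rule be_step)

lemma step_range: "0 \<le> step j" "step j < q"
  using x y by (auto simp: step_def)

text \<open>
  Summation by parts: along a closed path the changes over the vertical steps cancel those over
  the horizontal steps.
\<close>

lemma sum_rise_eq_sum_fall: "sum rise {0..<p} = sum fall {0..<p}"
  unfolding rise_def fall_def sum_subtractf
  using sum_succ[of "\<lambda>j. G (al j) (be j)"] by simp

lemma rise_le_1: "rise j \<le> 1"
  by (auto simp: rise_def cut_coeff_def)

lemma rise_succ:
  assumes "0 \<le> j" "j < p"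
  shows "rise (succ j) = G (down (al (succ j))) (be (succ (succ j))) - G (down (al (succ j))) (be (succ j))"
  unfolding rise_def using al_succ[OF succ_range] by simp

text \<open>
  If neither step is short, two successive gains occur only when the first one is in a column
  from \<open>v\<close> to \<open>u + v\<close>; the next column is then below \<open>u \<le> v\<close>, and a third gain would be in
  conflict with the second across the wrap-around.
\<close>

lemma bound_no_short:
  assumes "\<not> short x" "\<not> short y"
  shows "3 * sum rise {0..<p} \<le> 2 * p"
proof -
  have triple: "rise j + rise (succ j) + rise (succ (succ j)) \<le> 2" if j: "0 \<le> j" "j < p" for j
  proof (rule ccontr)
    assume "\<not> ?thesis"
    then have 1: "rise j = 1" "rise (succ j) = 1" "rise (succ (succ j)) = 1"
      using rise_le_1[of j] rise_le_1[of "succ j"] rise_le_1[of "succ (succ j)"] by linarith+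
    let ?a = "al (succ j)"
    have a: "0 \<le> ?a" "?a < p" "0 \<le> down ?a" using al_range succ_range p_pos by auto
    have "v \<le> down ?a"
      using wrap_conflict[of "down ?a" "be (succ (succ j))" "be (succ j)" "be (succ (succ (succ j)))"] 1 a
        rise_succ[OF succ_range, of j] al_succ[OF succ_range] rise_def[of "succ j"] by (cases "v \<le> down ?a") auto
    moreover have "v \<le> ?a"
      using wrap_conflict[of ?a "be (succ j)" "be j" "be (succ (succ j))"] 1 a rise_succ[OF j] rise_def[of j]
      by (cases "v \<le> ?a") auto
    ultimately have "u + v \<le> ?a" using down_eq[OF a(1,2)] u_le_v by auto
    note fs = free_short[OF this a(2), of "be j" "be (succ j)" "be (succ (succ j))"]
    have s: "0 < be (succ j) - be j" "be (succ j) - be j < q - t"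
      using fs 1 be_range rise_succ[OF j] by (auto simp: rise_def)
    have "(be (succ j) - be j) mod q = step j mod q" unfolding be_succ[OF j] by (simp add: mod_diff_left_eq)
    then have "step j = be (succ j) - be j" using s be_range step_range[of j]
      by (smt (verit) mod_pos_pos_trivial)
    with s assms show False by (auto simp: short_def step_def split: if_splits)
  qed
  have "3 * sum rise {0..<p} = (\<Sum>j\<in>{0..<p}. rise j + rise (succ j) + rise (succ (succ j)))"
    by (simp only: sum.distrib sum_succ[of "\<lambda>j. rise (succ j)"] sum_succ)
  also have "\<dots> \<le> (\<Sum>j\<in>{0..<p}. 2)" by (rule sum_mono) (use triple in auto)
  finally show ?thesis using p_pos by simp
qed

text \<open>
  This is where the size of \<open>d\<close> enters.  Of the two kinds of steps, \<open>x\<close> occurs \<open>p - d\<close> times and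
  \<open>y\<close> occurs \<open>d\<close> times, and the rarer one is always isolated.  Hence a step that is not short is
  followed by a short one exactly \<^term>\<open>min d (p - d)\<close> times, and each such occurrence costs a unit.
\<close>

lemma bound_one_short:
  assumes one: "short x \<noteq> short y" and d3: "p \<le> 3 * d" "p \<le> 3 * (p - d)"
  shows "3 * sum rise {0..<p} \<le> 2 * p"
proof -
  \<comment> \<open>the indices at which a step that is not short is followed by a short one\<close>
  define Z where "Z = (if short x then {p - d..<min p (2 * (p - d))} else {max 0 (p - 2 * d)..<p - d})"
  have Z_sub: "Z \<subseteq> {0..<p}" using d by (auto simp: Z_def)
  have steps: "\<not> short (step j)" "short (step (succ j))" if "j \<in> Z" for j
    using that one d Z_sub by (auto simp: Z_def step_def succ_eq split: if_splits)
  have "sum rise {0..<p} \<le> int (card {0..<p}) - int (card Z)"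
  proof (rule sum_le_card_minus_pairs)
    show "inj_on succ Z" using succ_inj Z_sub inj_on_subset by blast
    show "succ ` Z \<subseteq> {0..<p}" using succ_range by auto
    show "Z \<inter> succ ` Z = {}" using steps by blast
    fix j assume jZ: "j \<in> Z"
    then have j: "0 \<le> j" "j < p" using Z_sub by auto
    show "rise j + rise (succ j) \<le> 1"
      unfolding rise_succ[OF j] unfolding rise_def
      using long_short_conflict[of "al (succ j)" "be j" "be (succ j)" "step j" "be (succ (succ j))" "step (succ j)"]
        al_range[OF succ_range] be_range be_succ[OF j] be_succ[OF succ_range] step_range steps[OF jZ]
      by (simp add: short_def)
  qed (use rise_le_1 Z_sub in auto)
  moreover have "p \<le> 3 * int (card Z)" using d d3 by (auto simp: Z_def min_def max_def)
  ultimately show ?thesis using p_pos by simp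
qed

lemma card_al_preimage:
  assumes "X \<subseteq> {0..<p}"
  shows "card {j \<in> {0..<p}. al j \<in> X} = card X"
proof (rule bij_betw_same_card[of al])
  show "bij_betw al {j \<in> {0..<p}. al j \<in> X} X"
  proof (rule bij_betw_imageI)
    show "inj_on al {j \<in> {0..<p}. al j \<in> X}"
      using al_bij by (auto simp: bij_betw_def intro: inj_on_subset)
    have "X \<subseteq> al ` {0..<p}" using al_bij assms by (simp add: bij_betw_def)
    then show "al ` {j \<in> {0..<p}. al j \<in> X} = X" by blast
  qed
qed

lemma fall_unfold: "0 \<le> j \<Longrightarrow> j < p \<Longrightarrow> fall j = G (al j) (be j) - G (down (al j)) (be j)"
  by (simp add: fall_def al_succ)

lemma sum_fall_le:
  assumes X: "X \<subseteq> {0..<p}"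
    and nonpos: "\<And>j. 0 \<le> j \<Longrightarrow> j < p \<Longrightarrow> al j \<notin> X \<Longrightarrow> fall j \<le> 0"
  shows "sum fall {0..<p} \<le> sum fall {j \<in> {0..<p}. al j \<in> X}"
    "sum fall {0..<p} \<le> int (card X)"
proof -
  let ?S = "{j \<in> {0..<p}. al j \<in> X}"
  have "sum fall {0..<p} = sum fall ?S + sum fall ({0..<p} - ?S)"
    by (subst add.commute, rule sum.subset_diff) auto
  also have "sum fall ({0..<p} - ?S) \<le> 0" by (rule sum_nonpos) (use nonpos in auto)
  finally show 1: "sum fall {0..<p} \<le> sum fall ?S" by simp
  also have "\<dots> \<le> (\<Sum>j\<in>?S. 1)"
    using al_range fall_le_1 by (intro sum_mono) (auto simp: fall_unfold)
  finally show "sum fall {0..<p} \<le> int (card X)" using card_al_preimage[OF X] by simp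
qed

text \<open>
  If both steps are short, the horizontal steps are counted instead.  Columns outside \<open>E\<close> give no
  gain, which is enough for \<open>v \<ge> p / 3\<close>.  Columns in the upper part of \<open>E\<close> gain only between
  \<open>k\<close> and \<open>k + u + v\<close>, which is enough for \<open>u + v \<le> p / 3\<close>.  In between, if \<open>k\<close> is large then many
  upper columns lie below that window, and if \<open>k\<close> is small then many low columns are in conflict
  with their successors.
\<close>

lemma bound_both_short:
  assumes "short x" "short y"
  shows "3 * sum fall {0..<p} \<le> 2 * p"
proof -
  define k where "k = (N + p) div q"
  define E where "E = {0..<u} \<union> {u + v..<p}"
  have E_sub: "E \<subseteq> {0..<p}" using u_pos v_pos uv_le by (auto simp: E_def)
  have out: "fall j \<le> 0" if "0 \<le> j" "j < p" "al j \<notin> E" for j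
    using that al_range[OF that(1,2)] fall_nonpos by (auto simp: E_def fall_unfold)
  have high: "k < al j" "al j \<le> k + u + v"
    if "0 \<le> j" "j < p" "u + v \<le> al j" "\<not> fall j \<le> 0" for j
  proof -
    have "G (al j) (be j) - G (down (al j)) (be j) = 1"
      using that fall_le_1[of "al j" "be j"] al_range[OF that(1,2)] by (simp add: fall_unfold)
    then show "k < al j" "al j \<le> k + u + v"
      using fall_high[of "al j" "be j"] that al_range[OF that(1,2)] be_range by (auto simp: k_def)
  qed
  consider (A) "p \<le> 3 * v" | (B) "3 * (u + v) \<le> p" | (T) "3 * v < p" "p < 3 * (u + v)" "p - 3 * v \<le> 3 * (k + 1 - u - v)"
    | (L) "3 * v < p" "p < 3 * (u + v)" "3 * (k + 1 - u - v) < p - 3 * v"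
    by linarith
  then show ?thesis
  proof cases
    case A
    have "sum fall {0..<p} \<le> int (card E)" by (rule sum_fall_le(2)[OF E_sub out])
    also have "card E \<le> card {0..<u} + card {u + v..<p}" unfolding E_def by (rule card_Un_le)
    finally show ?thesis using A u_pos uv_le by simp
  next
    case B
    have "sum fall {0..<p} \<le> int (card ({0..<p} \<inter> ({0..<u} \<union> {k<..k + u + v})))"
    proof (rule sum_fall_le(2))
      fix j assume j: "0 \<le> j" "j < p" "al j \<notin> {0..<p} \<inter> ({0..<u} \<union> {k<..k + u + v})"
      show "fall j \<le> 0"
        using out[OF j(1,2)] high[OF j(1,2)] al_range[OF j(1,2)] j(3) by (force simp: E_def)
    qed auto
    also have "card ({0..<p} \<inter> ({0..<u} \<union> {k<..k + u + v})) \<le> card ({0..<u} \<union> {k<..k + u + v})"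
      by (rule card_mono) auto
    also have "\<dots> \<le> card {0..<u} + card {k<..k + u + v}" by (rule card_Un_le)
    finally show ?thesis using B u_pos v_pos by simp
  next
    case T
    have "sum fall {0..<p} \<le> int (card (E \<inter> ({0..<u} \<union> {k<..<p})))"
    proof (rule sum_fall_le(2))
      fix j assume j: "0 \<le> j" "j < p" "al j \<notin> E \<inter> ({0..<u} \<union> {k<..<p})"
      show "fall j \<le> 0"
        using out[OF j(1,2)] high[OF j(1,2)] al_range[OF j(1,2)] j(3) by (force simp: E_def)
    qed (use E_sub in auto)
    also have "card (E \<inter> ({0..<u} \<union> {k<..<p})) \<le> card ({0..<u} \<union> {k<..<p})"
      by (rule card_mono) auto
    also have "\<dots> \<le> card {0..<u} + card {k<..<p}" by (rule card_Un_le)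
    finally have "sum fall {0..<p} \<le> int (card {0..<u}) + int (card {k<..<p})" by simp
    moreover have "int (card {0..<u}) = u" using u_pos by simp
    moreover have "3 * int (card {k<..<p}) \<le> 2 * p - 3 * u"
      using T(1,3) u_le_v u_pos by (cases "k < p") auto
    ultimately show ?thesis by linarith
  next
    case L
    define S where "S = {j \<in> {0..<p}. al j \<in> E}"
    define X where "X = {max 0 (k + u + v - p + 1)..<u}"
    define Z where "Z = {j \<in> {0..<p}. al j \<in> X}"
    have XE: "X \<subseteq> E" "X \<subseteq> {0..<p}" using E_sub by (auto simp: X_def E_def)
    have down_high: "u + v \<le> al (succ j)" if "j \<in> Z" for j
    proof -
      have "al (succ j) = al j - v + p"
        using that al_succ[of j] down_eq[of "al j"] al_range[of j] u_le_v by (auto simp: Z_def X_def)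
      then show ?thesis using that al_range[of j] L u_le_v by (auto simp: Z_def)
    qed
    have "sum fall {0..<p} \<le> sum fall S" unfolding S_def by (rule sum_fall_le(1)[OF E_sub out])
    also have "\<dots> \<le> int (card S) - int (card Z)"
    proof (rule sum_le_card_minus_pairs)
      show "Z \<subseteq> S" using XE by (auto simp: Z_def S_def)
      show "inj_on succ Z" using succ_inj by (rule inj_on_subset) (auto simp: Z_def)
      show "succ ` Z \<subseteq> S" using down_high succ_range al_range[OF succ_range] by (auto simp: S_def E_def)
      show "Z \<inter> succ ` Z = {}" using down_high v_pos by (force simp: Z_def X_def)
      fix j assume "j \<in> Z"
      then have j: "0 \<le> j" "j < p" "al j \<in> X" by (auto simp: Z_def)
      show "fall j + fall (succ j) \<le> 1"
        unfolding fall_unfold[OF j(1,2)] fall_unfold[OF succ_range] al_succ[OF j(1,2)]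
        by (rule fall_low_conflict[OF _ _ _ _ _ _ be_succ[OF j(1,2)]])
           (use j L assms be_range u_le_v in \<open>auto simp: X_def k_def step_def short_def\<close>)
    next
      fix j assume "j \<in> S"
      then show "fall j \<le> 1" using al_range[of j] fall_le_1 by (auto simp: S_def fall_unfold)
    qed (unfold S_def, rule finite_Collect_conjI, simp)
    also have "card S = card E" unfolding S_def by (rule card_al_preimage[OF E_sub])
    also have "card Z = card X" unfolding Z_def by (rule card_al_preimage[OF XE(2)])
    finally have "sum fall {0..<p} \<le> int (card E) - int (card X)" .
    moreover have "int (card E) \<le> p - v"
      using card_Un_le[of "{0..<u}" "{u + v..<p}"] u_pos uv_le by (simp add: E_def)
    moreover have "int (card X) \<ge> min u (p - k - 1 - v)" by (auto simp: X_def)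
    ultimately show ?thesis using L u_le_v by (auto simp: min_def split: if_splits)
  qed
qed

lemma sum_fall_bound:
  assumes "p \<le> 3 * d" "p \<le> 3 * (p - d)"
  shows "3 * sum fall {0..<p} \<le> 2 * p"
  using bound_no_short bound_one_short[OF _ assms] bound_both_short sum_rise_eq_sum_fall
  by (cases "short x"; cases "short y") simp_all

end

section \<open>Linear flows and their symmetries\<close>

text \<open>
  In the application \<open>A - j w\<close> and \<open>B - j c\<close> are the coordinates of the exponent \<open>n - j\<close>.
\<close>

definition flow_sum :: "int \<Rightarrow> int \<Rightarrow> int \<Rightarrow> int \<Rightarrow> int \<Rightarrow> int \<Rightarrow> int \<Rightarrow> int \<Rightarrow> int \<Rightarrow> int \<Rightarrow> int" where
  "flow_sum p q w c u t N v A B = (\<Sum>j\<in>{0..<p}.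
     cut_coeff p q u t N ((A - j * w) mod p) ((B - j * c) mod q)
   - cut_coeff p q u t N ((A - j * w - v) mod p) ((B - j * c) mod q))"

lemma bij_betw_affine_mod:
  fixes p w A :: int
  assumes "0 < p" "coprime w p"
  shows "bij_betw (\<lambda>j. (A - j * w) mod p) {0..<p} {0..<p}"
proof -
  have "inj_on (\<lambda>j. (A - j * w) mod p) {0..<p}"
  proof (rule inj_onI)
    fix i j assume ij: "i \<in> {0..<p}" "j \<in> {0..<p}" "(A - i * w) mod p = (A - j * w) mod p"
    then have "p dvd (A - i * w) - (A - j * w)" by (simp add: mod_eq_dvd_iff)
    then have "p dvd (j - i) * w" by (simp add: algebra_simps)
    then have "p dvd j - i" using assms by (simp add: coprime_dvd_mult_left_iff coprime_commute)
    then have "j mod p = i mod p" by (simp add: mod_eq_dvd_iff)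
    then show "i = j" using ij by simp
  qed
  moreover have "(\<lambda>j. (A - j * w) mod p) ` {0..<p} \<subseteq> {0..<p}" using assms by auto
  ultimately show ?thesis by (simp add: bij_betw_def endo_inj_surj)
qed

lemma flow_sum_le:
  assumes u: "0 < u" "u \<le> v" "u + v \<le> p" and "0 < q" "\<bar>u * q + t * p - p * q\<bar> \<le> 1"
    and d: "p \<le> 3 * d" "p \<le> 3 * (p - d)" and w: "coprime w p" "(d * w) mod p = v mod p"
  shows "3 * flow_sum p q w c u t N v A B \<le> 2 * p"
proof -
  define al be where "al j = (A - j * w) mod p" and "be j = (B - j * c) mod q" for j
  have p: "0 < p" using u by linarith
  have dp: "0 < d" "d < p" using d p by auto
  have al_step: "al ((j + d) mod p) = (al j - v) mod p" for j
  proof -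
    have "p dvd (j + d) mod p - (j + d)" by (metis dvd_minus_mod dvd_diff_commute)
    then have "p dvd ((j + d) mod p - (j + d)) * w" by simp
    moreover have "p dvd d * w - v" using w by (simp add: mod_eq_dvd_iff)
    ultimately have "p dvd ((j + d) mod p - (j + d)) * w + (d * w - v)" by (rule dvd_add)
    then have "p dvd (A - j * w - v) - (A - (j + d) mod p * w)" by (simp add: algebra_simps)
    then have "(A - j * w - v) mod p = (A - (j + d) mod p * w) mod p" by (simp only: mod_eq_dvd_iff)
    then show ?thesis by (simp add: al_def mod_diff_left_eq)
  qed
  interpret flow p q u v t N d "(- (d * c)) mod q" "((p - d) * c) mod q" al be
  proof unfold_locales
    show "bij_betw al {0..<p} {0..<p}" unfolding al_def using bij_betw_affine_mod p w by blast
    fix j assume j: "0 \<le> j" "j < p"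
    show "al ((j + d) mod p) = (al j - v) mod p" by (rule al_step)
    show "be ((j + d) mod p) = (be j + (if j + d < p then (- (d * c)) mod q else ((p - d) * c) mod q)) mod q"
    proof (cases "j + d < p")
      case True
      then have "(j + d) mod p = j + d" using j dp by simp
      then show ?thesis using True by (simp add: be_def mod_add_eq algebra_simps)
    next
      case False
      have "(j + d) mod p = (j + d - p) mod p" by simp
      also have "\<dots> = j + d - p" using False j dp by (intro mod_pos_pos_trivial) auto
      finally have j': "(j + d) mod p = j + d - p" .
      show ?thesis using False unfolding be_def j' by (simp add: mod_add_eq algebra_simps)
    qed
  qed (use assms dp p in \<open>auto simp: be_def\<close>)
  have "flow_sum p q w c u t N v A B = sum fall {0..<p}"
    unfolding flow_sum_def fall_def
    by (intro sum.cong refl, subst al_succ) (auto simp: al_def be_def mod_diff_left_eq)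
  then show ?thesis using sum_fall_bound[OF assms(6,7)] by simp
qed

text \<open>
  Two reflections negate the sum.  The first starts in the column \<open>A - v\<close> and steps up instead of
  down; the second moves the origin of the torus to \<open>(u, t)\<close>.  The
  first one replaces \<open>d\<close> by \<open>p - d\<close>, under which the hypotheses on \<open>d\<close> are symmetric.
\<close>

lemma flow_sum_flip_v:
  "flow_sum p q w c u t N v A B = - flow_sum p q w c u t N (p - v) (A - v) B"
proof -
  have "A - v - j * w - (p - v) = A - j * w - p" "A - v - j * w = A - j * w - v" for j
    by simp_all
  then have "(A - v - j * w - (p - v)) mod p = (A - j * w) mod p"
    "(A - v - j * w) mod p = (A - j * w - v) mod p" for j
    by (simp_all only: minus_mod_self2)
  then show ?thesis unfolding flow_sum_def by (simp add: sum_negf[symmetric])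
qed

lemma cut_coeff_flip:
  assumes "0 < u" "u < p" "0 < t" "t < q" and bez: "u * q + t * p = p * q + 1"
    and ab: "0 \<le> a" "a < p" "0 \<le> b" "b < q"
  shows "cut_coeff p q u t N a b = - cut_coeff p q (p - u) (q - t) (N - 1) ((a - u) mod p) ((b - t) mod q)"
  using assms unfolding diff_mod_eq[OF ab(1,2) assms(1,2)] diff_mod_eq[OF ab(3,4) assms(3,4)] cut_coeff_def
  by (auto simp: algebra_simps)

lemma flow_sum_flip_u:
  assumes "0 < u" "u < p" "0 < t" "t < q" "u * q + t * p = p * q + 1"
  shows "flow_sum p q w c u t N v A B = - flow_sum p q w c (p - u) (q - t) (N - 1) v (A - u) (B - t)"
  unfolding flow_sum_def sum_negf[symmetric]
proof (intro sum.cong refl)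
  fix j
  have eqs: "((A - j * w) mod p - u) mod p = (A - u - j * w) mod p"
    "((A - j * w - v) mod p - u) mod p = (A - u - j * w - v) mod p"
    "((B - j * c) mod q - t) mod q = (B - t - j * c) mod q"
    by (simp_all add: mod_diff_left_eq algebra_simps)
  have "cut_coeff p q u t N (a mod p) (b mod q)
    = - cut_coeff p q (p - u) (q - t) (N - 1) ((a mod p - u) mod p) ((b mod q - t) mod q)" for a b
    using assms by (intro cut_coeff_flip) auto
  then show "cut_coeff p q u t N ((A - j * w) mod p) ((B - j * c) mod q) -
         cut_coeff p q u t N ((A - j * w - v) mod p) ((B - j * c) mod q) =
         - (cut_coeff p q (p - u) (q - t) (N - 1) ((A - u - j * w) mod p) ((B - t - j * c) mod q) -
            cut_coeff p q (p - u) (q - t) (N - 1) ((A - u - j * w - v) mod p) ((B - t - j * c) mod q))"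
    by (simp add: eqs)
qed

lemma mod_mult_complement:
  fixes d w v p :: int
  assumes "(d * w) mod p = v mod p"
  shows "((p - d) * w) mod p = (p - v) mod p"
proof -
  have "p dvd p * (w - 1) - (d * w - v)"
    by (rule dvd_diff) (use assms in \<open>simp_all add: mod_eq_dvd_iff\<close>)
  also have "p * (w - 1) - (d * w - v) = (p - d) * w - (p - v)" by (simp add: algebra_simps)
  finally show ?thesis by (simp only: mod_eq_dvd_iff)
qed

text \<open>
  If \<open>u \<le> p / 2\<close>, the comparison of the two minima gives \<open>u \<le> v\<close> and \<open>u + v \<le> p\<close>.  Otherwise both
  reflections are applied, and their signs cancel.
\<close>

lemma flow_sum_le_unordered:
  assumes u: "0 < u" "u < p" "0 < t" "t < q" "u * q + t * p = p * q + 1"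
    and v: "0 < v" "v < p" "min u (p - u) \<le> min v (p - v)"
    and d: "p \<le> 3 * d" "p \<le> 3 * (p - d)" and w: "coprime w p" "(d * w) mod p = v mod p"
  shows "3 * flow_sum p q w c u t N v A B \<le> 2 * p"
proof (cases "2 * u \<le> p")
  case True
  then show ?thesis using assms by (intro flow_sum_le[where d = d]) auto
next
  case False
  have "((p - d) * w) mod p = (p - v) mod p"
    using w(2) by (rule mod_mult_complement)
  moreover have "(p - u) * q + (q - t) * p - p * q = -1" using u(5) by (simp add: algebra_simps)
  ultimately have "3 * flow_sum p q w c (p - u) (q - t) (N - 1) (p - v) (A - v - u) (B - t) \<le> 2 * p"
    using assms False by (intro flow_sum_le[where d = "p - d"]) auto
  then show ?thesis
    using flow_sum_flip_v[of p q w c u t N v A B] flow_sum_flip_u[OF u, of w c N "p - v" "A - v" B] by simp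
qed

lemma abs_flow_sum_le:
  assumes u: "0 < u" "u < p" "0 < t" "t < q" "u * q + t * p = p * q + 1"
    and v: "0 < v" "v < p" "min u (p - u) \<le> min v (p - v)"
    and d: "p \<le> 3 * d" "p \<le> 3 * (p - d)" and w: "coprime w p" "(d * w) mod p = v mod p"
  shows "3 * \<bar>flow_sum p q w c u t N v A B\<bar> \<le> 2 * p"
proof -
  have "((p - d) * w) mod p = (p - v) mod p"
    using w(2) by (rule mod_mult_complement)
  then have "3 * flow_sum p q w c u t N (p - v) (A - v) B \<le> 2 * p"
    using assms by (intro flow_sum_le_unordered[where d = "p - d"]) auto
  then show ?thesis
    using flow_sum_flip_v[of p q w c u t N v A B] flow_sum_le_unordered[OF assms, of c N A B] by linarith
qed

section \<open>The cyclotomic polynomial of a product of three primes\<close>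

abbreviation X_minus_1 :: "nat \<Rightarrow> complex poly" where "X_minus_1 n \<equiv> monom 1 n - 1"

lemma X_minus_1_nonzero:
  assumes "0 < n"
  shows "X_minus_1 n \<noteq> 0"
proof -
  have "poly (X_minus_1 n) 0 = -1" using assms by (simp add: poly_monom)
  then show ?thesis by auto
qed

lemma prod_unity_roots:
  assumes "0 < n"
  shows "(\<Prod>k\<in>{0<..n}. [:- cis (2 * pi * real k / real n), 1:]) = X_minus_1 n"
proof -
  define g where "g k = [:- cis (2 * pi * real k / real n), 1:]" for k
  have g0: "g 0 = g n" using assms by (simp add: g_def)
  have "g 0 * (\<Prod>k<n. g (Suc k)) = (\<Prod>k<n. g k) * g n"
    by (metis prod.lessThan_Suc prod.lessThan_Suc_shift)
  moreover have "g 0 \<noteq> 0" by (simp add: g_def)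
  ultimately have shift: "(\<Prod>k<n. g (Suc k)) = (\<Prod>k<n. g k)" using g0 by (simp add: mult.commute)
  have "(\<Prod>k\<in>{0<..n}. g k) = (\<Prod>k<n. g (Suc k))"
    by (rule prod.reindex_bij_witness[of _ Suc "\<lambda>k. k - 1"]) auto
  also note shift
  also have "(\<Prod>k<n. g k) = (\<Prod>z\<in>{z. z ^ n = 1}. [:- z, 1:])"
    unfolding g_def
    using prod.reindex_bij_betw[OF Complex.bij_betw_roots_unity[OF assms], of "\<lambda>z. [:- z, 1:]"] by simp
  also have "\<dots> = X_minus_1 n"
  proof -
    have "rsquarefree (X_minus_1 n)"
      using assms by (auto simp: rsquarefree_roots poly_monom pderiv_diff pderiv_monom power_0_left)
    from complex_poly_decompose_rsquarefree[OF this]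
    have "smult (lead_coeff (X_minus_1 n)) (\<Prod>z\<in>{z. z ^ n = 1}. [:- z, 1:]) = X_minus_1 n"
      by (simp add: poly_monom)
    moreover have "degree (X_minus_1 n) = n"
    proof -
      have "degree (X_minus_1 n) = degree (monom (1::complex) n)"
        unfolding diff_conv_add_uminus using assms by (intro degree_add_eq_left) (simp add: degree_monom_eq)
      then show ?thesis by (simp add: degree_monom_eq)
    qed
    then have "lead_coeff (X_minus_1 n) = 1" using assms by simp
    ultimately show ?thesis by simp
  qed
  finally show ?thesis by (simp add: g_def)
qed

lemma prod_unity_roots_multiples:
  assumes "0 < d" "0 < m"
  shows "(\<Prod>k\<in>{k \<in> {0<..d * m}. d dvd k}. [:- cis (2 * pi * real k / real (d * m)), 1:]) = X_minus_1 m"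
proof -
  have "(\<Prod>k\<in>{k \<in> {0<..d * m}. d dvd k}. [:- cis (2 * pi * real k / real (d * m)), 1:])
    = (\<Prod>i\<in>{0<..m}. [:- cis (2 * pi * real i / real m), 1:])"
    by (rule prod.reindex_bij_witness[of _ "\<lambda>i. d * i" "\<lambda>k. k div d"])
       (use assms in \<open>auto elim!: dvdE simp: mult_ac\<close>)
  then show ?thesis using prod_unity_roots[OF assms(2)] by simp
qed

text \<open>
  Inclusion and exclusion over the exponents \<open>k\<close> of the roots of unity: the exponents divisible by
  \<open>p\<close> belong to the roots of \<open>X^(q r) - 1\<close>, those divisible by \<open>p q\<close> to the roots of \<open>X^r - 1\<close>, and
  so on.
\<close>

lemma cyclotomic_poly_pqr:
  assumes primes: "prime p" "prime q" "prime r" and ne: "p \<noteq> q" "p \<noteq> r" "q \<noteq> r"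
  shows "cyclotomic_poly (p * q * r) * X_minus_1 (q * r) * X_minus_1 (p * r) * X_minus_1 (p * q) * X_minus_1 1
    = X_minus_1 (p * q * r) * X_minus_1 p * X_minus_1 q * X_minus_1 r"
proof -
  define n where "n = p * q * r"
  define f where "f k = [:- cis (2 * pi * real k / real n), 1:]" for k
  define F where "F P = (\<Prod>k\<in>{0<..n}. if P k then f k else 1)" for P
  have pos: "0 < p" "0 < q" "0 < r" using primes prime_gt_0_nat by auto
  have F_dvd: "X_minus_1 m = F (\<lambda>k. d dvd k)" if "n = d * m" "0 < d" "0 < m" for d m
    unfolding F_def f_def that(1) prod_unity_roots_multiples[OF that(2,3), symmetric]
    by (simp only: prod.inter_filter[OF finite_greaterThanAtMost])
  have cop: "coprime p q" "coprime p r" "coprime q r"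
    using primes ne by (auto intro: primes_coprime)
  have totatives: "coprime k n \<longleftrightarrow> \<not> p dvd k \<and> \<not> q dvd k \<and> \<not> r dvd k" for k
    using primes by (auto simp: n_def coprime_mult_right_iff prime_imp_coprime coprime_commute[of k]
        dest: coprime_common_divisor)
  have 2: "p * q dvd k \<longleftrightarrow> p dvd k \<and> q dvd k" "p * r dvd k \<longleftrightarrow> p dvd k \<and> r dvd k"
    "q * r dvd k \<longleftrightarrow> q dvd k \<and> r dvd k" for k
    using cop by (auto intro: divides_mult dvd_mult_left dvd_mult_right)
  have 3: "n dvd k \<longleftrightarrow> p dvd k \<and> q dvd k \<and> r dvd k" for k
    unfolding n_def using cop 2 by (auto intro: divides_mult dvd_mult_left dvd_mult_right)
  have "cyclotomic_poly n = F (\<lambda>k. coprime k n)"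
    unfolding cyclotomic_poly_def F_def f_def totatives_def
    by (simp only: prod.inter_filter[OF finite_greaterThanAtMost])
  moreover have "X_minus_1 (q * r) = F (\<lambda>k. p dvd k)" "X_minus_1 (p * r) = F (\<lambda>k. q dvd k)"
    "X_minus_1 (p * q) = F (\<lambda>k. r dvd k)" "X_minus_1 1 = F (\<lambda>k. n dvd k)"
    "X_minus_1 n = F (\<lambda>k. 1 dvd k)" "X_minus_1 p = F (\<lambda>k. q * r dvd k)"
    "X_minus_1 q = F (\<lambda>k. p * r dvd k)" "X_minus_1 r = F (\<lambda>k. p * q dvd k)"
    by (rule F_dvd; use pos in \<open>simp add: n_def\<close>)+
  ultimately show ?thesis
    unfolding n_def[symmetric]
    by (simp only: F_def prod.distrib[symmetric], intro prod.cong refl)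
       (auto simp: totatives 2 3)
qed

lemma geometric_monom:
  "(\<Sum>a<k. monom 1 (a * m)) * X_minus_1 m = X_minus_1 (k * m)"
  by (induction k) (simp_all add: algebra_simps mult_monom one_poly_eq_simps flip: monom_0)

text \<open>
  The division is cleared by geometric sums.  The factor \<open>(X^(p q r) - 1)^2\<close> does not affect the
  coefficients below \<open>p q r\<close>.
\<close>

lemma cyclotomic_poly_pqr_product:
  assumes primes: "prime p" "prime q" "prime r" and ne: "p \<noteq> q" "p \<noteq> r" "q \<noteq> r"
  shows "cyclotomic_poly (p * q * r) * X_minus_1 (p * q * r) ^ 2
    = (\<Sum>a<p. monom 1 (a * (q * r))) * (\<Sum>b<q. monom 1 (b * (p * r))) * (\<Sum>c<r. monom 1 (c * (p * q)))
      * (\<Sum>j<p. monom 1 j) * X_minus_1 q * X_minus_1 r"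
proof -
  let ?n = "p * q * r" and ?Phi = "cyclotomic_poly (p * q * r)"
  let ?P = "\<Sum>a<p. monom 1 (a * (q * r))" and ?Q = "\<Sum>b<q. monom 1 (b * (p * r))"
    and ?R = "\<Sum>c<r. monom 1 (c * (p * q))" and ?J = "\<Sum>j<p. monom (1::complex) j"
  have P: "?P * X_minus_1 (q * r) = X_minus_1 ?n" "?Q * X_minus_1 (p * r) = X_minus_1 ?n"
    "?R * X_minus_1 (p * q) = X_minus_1 ?n"
    unfolding geometric_monom by (simp_all only: mult_ac)
  have J: "?J * X_minus_1 1 = X_minus_1 p" using geometric_monom[where k = p and m = 1] by simp
  have "?n > 0" using primes prime_gt_0_nat by simp
  then have nz: "X_minus_1 ?n \<noteq> 0" by (rule X_minus_1_nonzero)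
  have nz1: "X_minus_1 1 \<noteq> 0" by (rule X_minus_1_nonzero) simp
  have "(?Phi * X_minus_1 ?n ^ 2) * (X_minus_1 ?n * X_minus_1 1)
    = (?Phi * X_minus_1 (q * r) * X_minus_1 (p * r) * X_minus_1 (p * q) * X_minus_1 1) * (?P * ?Q * ?R)"
    unfolding power2_eq_square by (subst (1) P(1)[symmetric], subst P(2)[symmetric], subst P(3)[symmetric]) (simp only: mult_ac)
  also have "\<dots> = (?P * ?Q * ?R * ?J * X_minus_1 q * X_minus_1 r) * (X_minus_1 ?n * X_minus_1 1)"
    unfolding cyclotomic_poly_pqr[OF primes ne] J[symmetric] by (simp only: mult_ac)
  finally show ?thesis using nz nz1 by (simp only: mult_cancel_right mult_eq_0_iff simp_thms)
qed

section \<open>Coefficients as sums along a flow\<close>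

text \<open>
  Describing the coefficients by a function on all integers that vanishes on the negative ones
  turns multiplication by a monomial into a translation without case distinctions.
\<close>

definition represents :: "nat \<Rightarrow> complex poly \<Rightarrow> (int \<Rightarrow> int) \<Rightarrow> bool" where
  "represents M F g \<longleftrightarrow> (\<forall>m<M. coeff F m = of_int (g (int m))) \<and> (\<forall>m<0. g m = 0)"

lemma represents_shift:
  assumes "represents M F g"
  shows "represents M (monom 1 k * F) (\<lambda>m. g (m - int k))"
  unfolding represents_def
proof (intro conjI allI impI)
  fix m assume "m < M"
  then show "coeff (monom 1 k * F) m = of_int (g (int m - int k))"
    using assms by (cases "m < k") (auto simp: represents_def coeff_monom_mult of_nat_diff)
qed (use assms in \<open>auto simp: represents_def\<close>)

lemma represents_diff:
  "represents M F g \<Longrightarrow> represents M H h \<Longrightarrow> represents M (F - H) (\<lambda>m. g m - h m)"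
  by (auto simp: represents_def)

lemma represents_sum:
  assumes "\<And>i. i \<in> I \<Longrightarrow> represents M (F i) (g i)"
  shows "represents M (\<Sum>i\<in>I. F i) (\<lambda>m. \<Sum>i\<in>I. g i m)"
  using assms by (auto simp: represents_def coeff_sum intro!: sum.cong sum.neutral)

text \<open>
  If \<open>w\<close> and \<open>c\<close> are inverse to \<open>q r\<close> modulo \<open>p\<close> and to \<open>p r\<close> modulo \<open>q\<close>, this is the number of ways
  to write \<open>m < p q r\<close> as \<open>x q r + y p r + z p q\<close> with \<open>0 \<le> x < p\<close>, \<open>0 \<le> y < q\<close>, \<open>0 \<le> z < r\<close>: the
  congruences determine \<open>x\<close> and \<open>y\<close>, and what remains for \<open>z\<close> only has to be nonnegative.
\<close>

definition box_count :: "int \<Rightarrow> int \<Rightarrow> int \<Rightarrow> int \<Rightarrow> int \<Rightarrow> int \<Rightarrow> int" where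
  "box_count p q r w c m = (if r * ((w * m) mod p * q + (c * m) mod q * p) \<le> m then 1 else 0)"

lemma dvd_minus_box:
  fixes p q r w c l :: int
  assumes w: "(w * (q * r)) mod p = 1 mod p" and c: "(c * (p * r)) mod q = 1 mod q" and cop: "coprime p q"
  shows "p * q dvd l - r * ((w * l) mod p * q + (c * l) mod q * p)"
proof -
  let ?a = "(w * l) mod p" and ?b = "(c * l) mod q"
  let ?f = "?a * q + ?b * p"
  have w': "p dvd w * (q * r) - 1" and c': "q dvd c * (p * r) - 1"
    using w c by (simp_all add: mod_eq_dvd_iff)
  have "p dvd (w * (q * r) - 1) * l + p * (r * ?b) - (w * l - ?a) * (q * r)"
    by (rule dvd_diff[OF dvd_add[OF dvd_mult2[OF w'] dvd_triv_left] dvd_mult2]) (simp add: minus_mod_eq_mult_div)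
  also have "\<dots> = - (l - r * ?f)" by (simp add: algebra_simps)
  finally have "p dvd l - r * ?f" by (simp only: dvd_minus_iff)
  moreover have "q dvd (c * (p * r) - 1) * l + q * (r * ?a) - (c * l - ?b) * (p * r)"
    by (rule dvd_diff[OF dvd_add[OF dvd_mult2[OF c'] dvd_triv_left] dvd_mult2]) (simp add: minus_mod_eq_mult_div)
  then have "q dvd - (l - r * ?f)" by (simp add: algebra_simps)
  then have "q dvd l - r * ?f" by (simp only: dvd_minus_iff)
  ultimately show ?thesis using cop by (rule divides_mult)
qed

lemma box_solution:
  fixes p q r w c m :: int
  assumes pos: "0 < p" "0 < q" "0 < r" and m: "m < p * q * r"
    and w: "(w * (q * r)) mod p = 1 mod p" and c: "(c * (p * r)) mod q = 1 mod q" and cop: "coprime p q"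
  shows "(\<exists>z. 0 \<le> z \<and> z < r \<and> (w * m) mod p * q * r + (c * m) mod q * p * r + z * (p * q) = m)
      \<longleftrightarrow> r * ((w * m) mod p * q + (c * m) mod q * p) \<le> m"
    and "\<And>x y z. \<lbrakk>0 \<le> x; x < p; 0 \<le> y; y < q; x * q * r + y * p * r + z * (p * q) = m\<rbrakk>
      \<Longrightarrow> x = (w * m) mod p \<and> y = (c * m) mod q"
proof -
  let ?a = "(w * m) mod p" and ?b = "(c * m) mod q"
  let ?f = "?a * q + ?b * p"
  have w': "p dvd w * (q * r) - 1" and c': "q dvd c * (p * r) - 1"
    using w c by (simp_all add: mod_eq_dvd_iff)
  have "p * q dvd m - r * ?f" using w c cop by (rule dvd_minus_box)
  then obtain z where z: "m - r * ?f = p * q * z" by (elim dvdE)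
  have pq: "0 < p * q" using pos by simp
  have "0 \<le> ?f" using pos by simp
  then have "0 \<le> r * ?f" using pos by simp
  show "(\<exists>z. 0 \<le> z \<and> z < r \<and> ?a * q * r + ?b * p * r + z * (p * q) = m) \<longleftrightarrow> r * ?f \<le> m"
  proof
    assume "\<exists>z. 0 \<le> z \<and> z < r \<and> ?a * q * r + ?b * p * r + z * (p * q) = m"
    then obtain z where "0 \<le> z" "?a * q * r + ?b * p * r + z * (p * q) = m" by blast
    moreover from this have "0 \<le> z * (p * q)" using pq by simp
    ultimately show "r * ?f \<le> m" by (simp add: algebra_simps)
  next
    assume le: "r * ?f \<le> m"
    then have "0 \<le> p * q * z" using z by linarith
    then have "0 \<le> z" using pq by (simp add: zero_le_mult_iff)
    moreover have "p * q * z < p * q * r" using z m \<open>0 \<le> r * ?f\<close> by linarith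
    then have "z < r" using pq by (simp add: mult_less_cancel_left)
    ultimately show "\<exists>z. 0 \<le> z \<and> z < r \<and> ?a * q * r + ?b * p * r + z * (p * q) = m"
      using z by (intro exI[of _ z]) (simp add: algebra_simps)
  qed
  fix x y z assume xyz: "0 \<le> x" "x < p" "0 \<le> y" "y < q" "x * q * r + y * p * r + z * (p * q) = m"
  have "p dvd (w * (q * r) - 1) * x + p * (w * (y * r + z * q))"
    by (rule dvd_add[OF dvd_mult2[OF w'] dvd_triv_left])
  also have "\<dots> = w * m - x" unfolding xyz(5)[symmetric] by (simp add: algebra_simps)
  finally have "(w * m) mod p = x mod p" by (simp only: mod_eq_dvd_iff)
  moreover have "q dvd (c * (p * r) - 1) * y + q * (c * (x * r + z * p))"
    by (rule dvd_add[OF dvd_mult2[OF c'] dvd_triv_left])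
  then have "q dvd c * m - y" unfolding xyz(5)[symmetric] by (simp add: algebra_simps)
  then have "(c * m) mod q = y mod q" by (simp only: mod_eq_dvd_iff)
  ultimately show "x = (w * m) mod p \<and> y = (c * m) mod q" using xyz by simp
qed


lemma represents_box:
  assumes pos: "0 < p" "0 < q" "0 < r" and cop: "coprime p q"
    and w: "(w * (int q * int r)) mod int p = 1 mod int p" and c: "(c * (int p * int r)) mod int q = 1 mod int q"
  shows "represents (p * q * r)
    ((\<Sum>x<p. monom 1 (x * (q * r))) * (\<Sum>y<q. monom 1 (y * (p * r))) * (\<Sum>z<r. monom 1 (z * (p * q))))
    (box_count (int p) (int q) (int r) w c)"
  unfolding represents_def
proof (intro conjI allI impI)
  fix m assume m: "m < p * q * r"
  let ?a = "(w * int m) mod int p" and ?b = "(c * int m) mod int q"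
  define B where "B = {..<p} \<times> {..<q} \<times> {..<r}"
  define val where "val = (\<lambda>(x, y, z). x * (q * r) + (y * (p * r) + z * (p * q)))"
  have "(\<Sum>s\<in>B. monom (1::complex) (val s))
    = (\<Sum>x<p. \<Sum>y<q. \<Sum>z<r. monom 1 (x * (q * r)) * (monom 1 (y * (p * r)) * monom 1 (z * (p * q))))"
    by (simp add: B_def val_def sum.cartesian_product split_def mult_monom)
  also have "\<dots> = (\<Sum>x<p. monom 1 (x * (q * r))) * (\<Sum>y<q. monom 1 (y * (p * r))) * (\<Sum>z<r. monom 1 (z * (p * q)))"
    by (simp only: sum_distrib_left[symmetric] sum_distrib_right[symmetric] mult.assoc)
  finally have "(\<Sum>x<p. monom 1 (x * (q * r))) * (\<Sum>y<q. monom 1 (y * (p * r))) * (\<Sum>z<r. monom (1::complex) (z * (p * q)))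
    = (\<Sum>s\<in>B. monom 1 (val s))" by simp
  then have "coeff ((\<Sum>x<p. monom 1 (x * (q * r))) * (\<Sum>y<q. monom 1 (y * (p * r))) * (\<Sum>z<r. monom (1::complex) (z * (p * q)))) m
    = (\<Sum>s\<in>B. if val s = m then 1 else 0)"
    by (simp add: coeff_sum coeff_monom)
  also have "\<dots> = of_nat (card {s \<in> B. val s = m})"
    by (simp add: B_def sum.If_cases Int_def)
  also have "card {s \<in> B. val s = m} = (if int r * (?a * int q + ?b * int p) \<le> int m then 1 else 0)"
  proof -
    have m': "int m < int p * int q * int r" using m by (metis of_nat_less_iff of_nat_mult)
    have pos': "0 < int p" "0 < int q" "0 < int r" and cop': "coprime (int p) (int q)" using pos cop by auto
    note sol = box_solution[OF pos' m' w c cop']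
    have val_int: "int (val (x, y, z)) = int x * int q * int r + int y * int p * int r + int z * (int p * int q)" for x y z
      by (simp add: val_def)
    have ab: "int x = ?a" "int y = ?b" if "(x, y, z) \<in> B" "val (x, y, z) = m" for x y z
      using sol(2)[of "int x" "int y" "int z"] that val_int[of x y z] by (auto simp: B_def)
    show ?thesis
    proof (cases "int r * (?a * int q + ?b * int p) \<le> int m")
      case True
      then obtain z where z: "0 \<le> z" "z < int r" "?a * int q * int r + ?b * int p * int r + z * (int p * int q) = int m"
        using sol(1) by blast
      have "?a < int p" "0 \<le> ?a" "?b < int q" "0 \<le> ?b" using pos by auto
      then have range: "nat ?a < p" "nat ?b < q" "nat z < r" using z pos by (auto simp: nat_less_iff)
      have "{s \<in> B. val s = m} = {(nat ?a, nat ?b, nat z)}"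
      proof (intro equalityI subsetI)
        fix s assume "s \<in> {s \<in> B. val s = m}"
        moreover obtain x y k where s: "s = (x, y, k)" by (cases s)
        ultimately have s': "(x, y, k) \<in> B" "val (x, y, k) = m" by auto
        note xy = ab[OF s']
        have "int x * int q * int r + int y * int p * int r + int k * (int p * int q) = int m"
          using val_int[of x y k] s'(2) by simp
        then have "int k * (int p * int q) = z * (int p * int q)"
          using z(3) unfolding xy by linarith
        then have "int k = z" using pos by simp
        then show "s \<in> {(nat ?a, nat ?b, nat z)}" using xy by (simp add: s flip: xy)
      next
        fix s assume "s \<in> {(nat ?a, nat ?b, nat z)}"
        moreover have "int (val (nat ?a, nat ?b, nat z)) = int m"
          unfolding val_int using z \<open>0 \<le> ?a\<close> \<open>0 \<le> ?b\<close> by simp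
        ultimately show "s \<in> {s \<in> B. val s = m}" using range by (auto simp: B_def)
      qed
      then show ?thesis using True by simp
    next
      case False
      have "{s \<in> B. val s = m} = {}"
      proof (rule ccontr)
        assume "{s \<in> B. val s = m} \<noteq> {}"
        then obtain x y k where s': "(x, y, k) \<in> B" "val (x, y, k) = m" by auto
        note xy = ab[OF s']
        have "?a * int q * int r + ?b * int p * int r + int k * (int p * int q) = int m"
          unfolding xy[symmetric] val_int[symmetric] s'(2) by (rule refl)
        moreover have "0 \<le> int k" "int k < int r" using s' by (auto simp: B_def)
        ultimately show False using sol(1) False by blast
      qed
      then show ?thesis using False by (simp only: card.empty if_False)
    qed
  qed
  finally show "coeff ((\<Sum>x<p. monom 1 (x * (q * r))) * (\<Sum>y<q. monom 1 (y * (p * r))) * (\<Sum>z<r. monom (1::complex) (z * (p * q)))) m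
    = of_int (box_count (int p) (int q) (int r) w c (int m))"
    by (simp add: box_count_def)
next
  fix m :: int assume "m < 0"
  moreover have "0 \<le> int r * ((w * m) mod int p * int q + (c * m) mod int q * int p)" using pos by simp
  ultimately show "box_count (int p) (int q) (int r) w c m = 0" by (simp add: box_count_def)
qed


lemma coeff_cyclotomic_poly_pqr:
  assumes primes: "prime p" "prime q" "prime r" and ne: "p \<noteq> q" "p \<noteq> r" "q \<noteq> r"
    and w: "(w * (int q * int r)) mod int p = 1 mod int p" and c: "(c * (int p * int r)) mod int q = 1 mod int q"
    and n: "n < p * q * r"
  defines "g \<equiv> box_count (int p) (int q) (int r) w c"
  shows "coeff (cyclotomic_poly (p * q * r)) n = of_int (\<Sum>j<p.
    (g (int n - int j) - g (int n - int j - int r)) - (g (int n - int j - int q) - g (int n - int j - int q - int r)))"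
proof -
  define M where "M = p * q * r"
  define Box where "Box = (\<Sum>x<p. monom 1 (x * (q * r))) * (\<Sum>y<q. monom 1 (y * (p * r))) * (\<Sum>z<r. monom (1::complex) (z * (p * q)))"
  have pos: "0 < p" "0 < q" "0 < r" using primes prime_gt_0_nat by auto
  have Box: "represents M Box g"
    unfolding M_def Box_def g_def using primes ne w c pos by (intro represents_box) (auto intro: primes_coprime)
  have B1: "represents M (monom 1 r * Box - Box) (\<lambda>m. g (m - int r) - g m)" (is "represents M ?B1 ?g1")
    by (rule represents_diff[OF represents_shift[OF Box] Box])
  have B2: "represents M (monom 1 q * ?B1 - ?B1) (\<lambda>m. ?g1 (m - int q) - ?g1 m)" (is "represents M ?B2 ?g2")
    by (rule represents_diff[OF represents_shift[OF B1] B1])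
  have "represents M (\<Sum>j<p. monom 1 j * ?B2) (\<lambda>m. \<Sum>j<p. ?g2 (m - int j))"
    by (rule represents_sum) (rule represents_shift[OF B2])
  moreover have "(\<Sum>j<p. monom 1 j * ?B2) = cyclotomic_poly M * X_minus_1 M ^ 2"
    unfolding M_def cyclotomic_poly_pqr_product[OF primes ne] Box_def[symmetric]
    unfolding sum_distrib_right[symmetric] by (simp only: algebra_simps mult_1_left mult_1_right)
  moreover have "coeff (cyclotomic_poly M * X_minus_1 M ^ 2) n = coeff (cyclotomic_poly M) n"
  proof -
    have "cyclotomic_poly M * X_minus_1 M ^ 2
      = cyclotomic_poly M + monom 1 M * (cyclotomic_poly M * (X_minus_1 M - 1))"
      by (simp add: power2_eq_square algebra_simps)
    then show ?thesis using n by (simp add: coeff_monom_mult M_def)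
  qed
  moreover have "n < M" using n by (simp add: M_def)
  ultimately have "coeff (cyclotomic_poly M) n = of_int (\<Sum>j<p. ?g2 (int n - int j))"
    by (simp only: represents_def)
  also have "(\<Sum>j<p. ?g2 (int n - int j)) = (\<Sum>j<p. (g (int n - int j) - g (int n - int j - int r))
      - (g (int n - int j - int q) - g (int n - int j - int q - int r)))"
    by (intro sum.cong refl) simp
  finally show ?thesis unfolding M_def .
qed

text \<open>
  Translating \<open>m\<close> by \<open>r\<close> lowers the residue \<open>a q + b p\<close> modulo \<open>p q\<close> by one, so the difference
  of the two counts is a coefficient of the cyclotomic polynomial of index \<open>p q\<close>.  The cut-off
  may be taken at \<open>n div r\<close> for all the \<open>m\<close> under consideration: they differ from \<open>n\<close> by
  less than \<open>p q\<close>, and the two sides of the defining inequality are congruent modulo \<open>p q\<close>.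
\<close>

lemma box_count_diff:
  fixes p q r u t w c n m :: int
  assumes pos: "1 < p" "1 < q" "0 < r" and cop: "coprime p q"
    and w: "(w * (q * r)) mod p = 1 mod p" and c: "(c * (p * r)) mod q = 1 mod q"
    and u: "u = (w * r) mod p" and t: "t = (c * r) mod q" and bez: "u * q + t * p = p * q + 1"
    and ut: "0 < u" "0 < t"
    and n: "0 \<le> n" "n < p * q * r" and m: "n - (p - 1) - q \<le> m" "m \<le> n"
  shows "box_count p q r w c m - box_count p q r w c (m - r)
    = cut_coeff p q u t (n div r) ((w * m) mod p) ((c * m) mod q)"
proof -
  let ?a = "(w * m) mod p" and ?b = "(c * m) mod q"
  define N where "N = n div r"
  have up: "u < p" "t < q" using pos by (simp_all add: u t)
  have ab: "0 \<le> ?a" "?a < p" "0 \<le> ?b" "?b < q" using pos by simp_all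
  have ab': "(w * (m - r)) mod p = (?a - u) mod p" "(c * (m - r)) mod q = (?b - t) mod q"
    unfolding u t by (simp_all add: mod_diff_eq right_diff_distrib)
  let ?f = "?a * q + ?b * p" and ?f' = "(?a - u) mod p * q + (?b - t) mod q * p"
  have N: "0 \<le> N" "N < p * q" using n pos by (simp_all add: N_def int_div_less_iff pos_imp_zdiv_nonneg_iff)
  have key: "r * x \<le> m \<longleftrightarrow> x \<le> N" if dvd: "p * q dvd m - r * x" for x
  proof
    assume "r * x \<le> m"
    then have "\<not> n < x * r" using m by (simp add: mult.commute)
    then show "x \<le> N" unfolding N_def using int_div_less_iff[OF pos(3), of n x] by linarith
  next
    assume "x \<le> N"
    then have "x * r \<le> n" unfolding N_def using int_div_less_iff[OF pos(3), of n x] by linarith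
    moreover have "p + q - 1 < p * q"
    proof -
      have "0 < (p - 1) * (q - 1)" using pos by simp
      then show ?thesis by (simp add: algebra_simps)
    qed
    ultimately have "- (p * q) < m - r * x" using m by (simp add: mult.commute)
    moreover obtain k where k: "m - r * x = p * q * k" using dvd by (elim dvdE)
    ultimately have "p * q * (- 1) < p * q * k" by simp
    moreover have "0 < p * q" using pos by simp
    ultimately have "-1 < k" by (simp only: mult_less_cancel_left_pos)
    then have "0 \<le> p * q * k" using pos by simp
    then show "r * x \<le> m" using k by linarith
  qed
  have dvd_f: "p * q dvd l - r * ((w * l) mod p * q + (c * l) mod q * p)" for l
    using w c cop pos by (intro dvd_minus_box)
  have 1: "box_count p q r w c m = (if ?f \<le> N then 1 else 0)"
    unfolding box_count_def using key[OF dvd_f] by simp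
  have "p * q dvd m - r * (?f' + 1)" using dvd_f[of "m - r"] unfolding ab' by (simp add: algebra_simps)
  from key[OF this] have 2: "box_count p q r w c (m - r) = (if ?f' + 1 \<le> N then 1 else 0)"
    unfolding box_count_def ab' by (simp add: algebra_simps)
  have f0: "0 \<le> ?f" using ab pos by simp
  have f_big: "p * q < ?f" if "u \<le> ?a" "t \<le> ?b"
  proof -
    have "u * q \<le> ?a * q" "t * p \<le> ?b * p" using that pos by (auto intro: mult_right_mono)
    then show ?thesis using bez by linarith
  qed
  show ?thesis
    unfolding 1 2 cut_coeff_def N_def[symmetric] diff_mod_eq[OF ab(1,2) ut(1) up(1)] diff_mod_eq[OF ab(3,4) ut(2) up(2)]
    using f0 f_big N bez by (cases "?a < u"; cases "?b < t") (auto simp: algebra_simps)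
qed

section \<open>The height bound\<close>

lemma bezout_residues:
  fixes p q u t :: int
  assumes pq: "1 < p" "1 < q" and cop: "coprime p q" and u: "0 < u" "u < p" and t: "0 < t" "t < q"
    and "(u * q) mod p = 1 mod p" "(t * p) mod q = 1 mod q"
  shows "u * q + t * p = p * q + 1"
proof -
  have "p dvd u * q - 1" "q dvd t * p - 1" using assms(8,9) by (simp_all only: mod_eq_dvd_iff)
  then have "p dvd (u * q - 1) + p * t" "q dvd (t * p - 1) + q * u" by simp_all
  then have "p dvd u * q + t * p - 1" "q dvd u * q + t * p - 1" by (simp_all add: algebra_simps)
  then have "p * q dvd u * q + t * p - 1" using cop by (intro divides_mult)
  then obtain k where k: "u * q + t * p - 1 = p * q * k" by (elim dvdE)
  have "1 * q \<le> u * q" "1 * p \<le> t * p" using pq u t by (auto intro: mult_right_mono)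
  moreover have "u * q < p * q" "t * p < q * p" "q * p = p * q" using pq u t by simp_all
  ultimately have "0 < u * q + t * p - 1" "u * q + t * p - 1 < p * q * 2" using pq by linarith+
  then have "p * q * 0 < p * q * k" "p * q * k < p * q * 2" using k by linarith+
  moreover have "0 < p * q" using pq by simp
  ultimately have "0 < k" "k < 2" by (simp_all only: mult_less_cancel_left_pos)
  then have "k = 1" by simp
  then show ?thesis using k by simp
qed

text \<open>
  Here \<open>w r\<close> and \<open>w q\<close> are inverse to \<open>q\<close> and to \<open>r\<close> modulo \<open>p\<close>.  Their distances from the multiples
  of \<open>p\<close> are compared because the staircase needs \<open>u \<le> v\<close>; exchanging \<open>q\<close> and \<open>r\<close> achieves this.
\<close>

lemma coeff_bound_ordered:
  assumes primes: "prime p" "prime q" "prime r" and ne: "p \<noteq> q" "p \<noteq> r" "q \<noteq> r"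
    and w: "(w * (int q * int r)) mod int p = 1 mod int p"
    and d: "int p \<le> 3 * (int q mod int p)" "int p \<le> 3 * (int p - int q mod int p)"
    and ord: "min ((w * int r) mod int p) (int p - (w * int r) mod int p)
      \<le> min ((w * int q) mod int p) (int p - (w * int q) mod int p)"
    and n: "n < p * q * r"
  shows "3 * cmod (coeff (cyclotomic_poly (p * q * r)) n) \<le> 2 * real p"
proof -
  define P Q R where "P = int p" and "Q = int q" and "R = int r"
  have gt1: "1 < P" "1 < Q" "1 < R" using primes prime_gt_1_nat by (auto simp: P_def Q_def R_def)
  have cop: "coprime P Q" "coprime P R" "coprime Q R"
    using primes ne by (auto simp: P_def Q_def R_def intro: primes_coprime)
  have w': "(w * (Q * R)) mod P = 1" using w gt1 by (simp add: P_def Q_def R_def)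
  have "coprime (P * R) Q" using cop by (simp add: coprime_commute)
  then obtain c where "[P * R * c = 1] (mod Q)" using cong_solve_coprime_int by blast
  then have c: "(c * (P * R)) mod Q = 1" using gt1 by (simp add: cong_def mult.commute)
  define u t v where "u = (w * R) mod P" and "t = (c * R) mod Q" and "v = (w * Q) mod P"
  have uq: "(u * Q) mod P = 1" and vr: "(v * R) mod P = 1" and tp: "(t * P) mod Q = 1"
    using w' c by (simp_all add: u_def v_def t_def mod_mult_right_eq mult_ac)
  have nz: "u \<noteq> 0" "v \<noteq> 0" "t \<noteq> 0" using uq vr tp by auto
  have range: "0 < u" "u < P" "0 < v" "v < P" "0 < t" "t < Q"
  proof -
    have "0 < x mod k \<and> x mod k < k" if "1 < k" "x mod k \<noteq> 0" for x k :: int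
      using that pos_mod_sign[of k x] pos_mod_bound[of k x] by linarith
    then show "0 < u" "u < P" "0 < v" "v < P" "0 < t" "t < Q"
      using nz gt1 by (auto simp: u_def v_def t_def)
  qed
  have bez: "u * Q + t * P = P * Q + 1"
    using gt1 cop range uq tp by (intro bezout_residues) auto
  have cop_w: "coprime w P"
  proof (rule coprimeI)
    fix x assume "x dvd w" "x dvd P"
    then have "x dvd (w * (Q * R)) mod P" by (simp add: dvd_mod)
    then show "is_unit x" using w' by simp
  qed
  have dw: "((Q mod P) * w) mod P = v mod P" unfolding v_def mod_mod_trivial mod_mult_left_eq by (simp only: mult.commute)
  define S where "S = flow_sum P Q w c u t (int n div R) v (w * int n) (c * int n)"
  have "3 * \<bar>S\<bar> \<le> 2 * P"
    unfolding S_def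
    by (rule abs_flow_sum_le[OF _ _ _ _ bez _ _ _ _ _ cop_w dw])
       (use range d ord in \<open>simp_all add: P_def Q_def R_def u_def v_def\<close>)
  define g where "g = box_count P Q R w c"
  have count: "g m - g (m - R) = cut_coeff P Q u t (int n div R) ((w * m) mod P) ((c * m) mod Q)"
    if "int n - (P - 1) - Q \<le> m" "m \<le> int n" for m
  proof -
    have "int n < P * Q * R" unfolding P_def Q_def R_def using n by (metis of_nat_less_iff of_nat_mult)
    then show ?thesis
      unfolding g_def
      by (intro box_count_diff[OF gt1(1,2) _ cop(1) _ _ u_def t_def bez range(1,5) _ _ that])
         (use gt1 w' c in simp_all)
  qed
  have "coeff (cyclotomic_poly (p * q * r)) n = of_int (\<Sum>j<p.
    (g (int n - int j) - g (int n - int j - R)) - (g (int n - int j - Q) - g (int n - int j - Q - R)))"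
    unfolding g_def P_def Q_def R_def
    using coeff_cyclotomic_poly_pqr[OF primes ne _ _ n] w' c gt1 by (simp add: P_def Q_def R_def)
  also have "(\<Sum>j<p. (g (int n - int j) - g (int n - int j - R)) - (g (int n - int j - Q) - g (int n - int j - Q - R))) = S"
    unfolding S_def flow_sum_def
  proof (rule sum.reindex_bij_witness[of _ nat int])
    fix j assume j: "j \<in> {..<p}"
    have "(w * (int n - int j - Q)) mod P = (w * int n - int j * w - v) mod P"
      unfolding v_def mod_diff_right_eq by (simp add: algebra_simps)
    moreover have "(c * (int n - int j - Q)) mod Q = (c * int n - int j * c) mod Q"
    proof -
      have "c * (int n - int j - Q) = (c * int n - int j * c) + (- c) * Q" by (simp add: algebra_simps)
      then show ?thesis by (simp only: mod_mult_self1)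
    qed
    ultimately show "cut_coeff P Q u t (int n div R) ((w * int n - int j * w) mod P) ((c * int n - int j * c) mod Q)
        - cut_coeff P Q u t (int n div R) ((w * int n - int j * w - v) mod P) ((c * int n - int j * c) mod Q)
      = (g (int n - int j) - g (int n - int j - R)) - (g (int n - int j - Q) - g (int n - int j - Q - R))"
      using j gt1 count[of "int n - int j"] count[of "int n - int j - Q"]
      by (simp add: P_def algebra_simps)
  qed (auto simp: P_def)
  finally have "cmod (coeff (cyclotomic_poly (p * q * r)) n) = real_of_int \<bar>S\<bar>" by simp
  moreover have "real_of_int (3 * \<bar>S\<bar>) \<le> real_of_int (2 * P)"
    using \<open>3 * \<bar>S\<bar> \<le> 2 * P\<close> by (simp only: of_int_le_iff)
  ultimately show ?thesis by (simp add: P_def)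
qed

theorem corollary3p4:
  fixes p q r :: nat
  assumes "prime p" and "prime q" and "prime r"
    and "odd p" and "odd q" and "odd r"
    and "p < q" and "q < r"
    and "real (Min {q mod p, p - q mod p, r mod p, p - r mod p}) > (real p - 1) / 3"
  shows "cyclotomic_height (p * q * r) \<le> 2 / 3 * real p"
proof -
  have gt1: "1 < p" "1 < q" "1 < r" using assms prime_gt_1_nat by auto
  have ne: "p \<noteq> q" "p \<noteq> r" "q \<noteq> r" using assms by auto
  define M where "M = Min {q mod p, p - q mod p, r mod p, p - r mod p}"
  have "real p < real (3 * M + 1)" using assms(9) unfolding M_def[symmetric] by simp
  then have "p \<le> 3 * M" by (simp only: of_nat_less_iff)
  moreover have "M \<le> x" if "x \<in> {q mod p, p - q mod p, r mod p, p - r mod p}" for x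
    unfolding M_def using that by (intro Min_le) auto
  ultimately have "p \<le> 3 * x" if "x \<in> {q mod p, p - q mod p, r mod p, p - r mod p}" for x
    using that by (meson le_trans mult_le_mono2)
  then have "p \<le> 3 * (q mod p)" "p \<le> 3 * (p - q mod p)" "p \<le> 3 * (r mod p)" "p \<le> 3 * (p - r mod p)"
    by blast+
  then have int_mods: "int p \<le> 3 * (int q mod int p)" "int p \<le> 3 * (int p - int q mod int p)"
    "int p \<le> 3 * (int r mod int p)" "int p \<le> 3 * (int p - int r mod int p)"
    using gt1 by (simp_all flip: of_nat_mod)
  have "coprime (int q * int r) (int p)"
    using assms ne by (auto simp: coprime_commute intro: primes_coprime)
  then obtain w where "[int q * int r * w = 1] (mod int p)" using cong_solve_coprime_int by blast
  then have w: "(w * (int q * int r)) mod int p = 1 mod int p" by (simp add: cong_def mult.commute)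
  then have w': "(w * (int r * int q)) mod int p = 1 mod int p" by (simp add: mult_ac)
  have bound: "3 * cmod (coeff (cyclotomic_poly (p * q * r)) n) \<le> 2 * real p" if n: "n < p * q * r" for n
  proof (cases "min ((w * int r) mod int p) (int p - (w * int r) mod int p)
      \<le> min ((w * int q) mod int p) (int p - (w * int q) mod int p)")
    case True
    show ?thesis by (rule coeff_bound_ordered[OF assms(1-3) ne w int_mods(1,2) True n])
  next
    case False
    then have ord: "min ((w * int q) mod int p) (int p - (w * int q) mod int p)
      \<le> min ((w * int r) mod int p) (int p - (w * int r) mod int p)" by linarith
    have comm: "p * r * q = p * q * r" by simp
    have "3 * cmod (coeff (cyclotomic_poly (p * r * q)) n) \<le> 2 * real p"
      using n unfolding comm[symmetric]
      by (rule coeff_bound_ordered[OF assms(1,3,2) ne(2,1) ne(3)[symmetric] w' int_mods(3,4) ord])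
    then show ?thesis unfolding comm .
  qed
  have "1 < p * q * r" using gt1 by (metis less_1_mult)
  then have "totient (p * q * r) < p * q * r" by (rule totient_less)
  then have "cmod (coeff (cyclotomic_poly (p * q * r)) n) \<le> 2 / 3 * real p" if "n \<le> totient (p * q * r)" for n
    using bound[of n] that by simp
  then show ?thesis unfolding cyclotomic_height_def by (subst Max_le_iff) auto
qed

end
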